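(* Let $q\in\mathbb{C}^*$ be fixed or seen as a formal parameter. Integrating to time $t=1$ the operator $D_0=(1+(q-1)x)(1+(x-1)q)\partial$, seen as a vector field in the hyperbolic plane $\mathbb{H}^2$, gives the Möbius transformation $$x\mapsto\gamma_x(1)=\frac{\left(qe^q+(q-1)^2e^{-(q-1)^2}\right)x+(1-q)\left(e^q-e^{-(q-1)^2}\right)}{q(1-q)\left(e^q-e^{-(q-1)^2}\right)x+(1-q)^2e^q+qe^{-(q-1)^2}} .$$
   Context: $\mathbb{H}^2\subset\mathbb{C}$ is the upper half-plane model with coordinate $x\in\mathbb{C}$, and $\partial=\frac{d}{dx}$. Integrating the vector field $p(x)\partial$ from the initial point $x$ means taking the curve $\gamma_x$ with $\gamma_x'(t)=p(\gamma_x(t))$ and $\gamma_x(0)=x$; here $p(x)=(1+(q-1)x)(1+(x-1)q)$.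
   Formalization: If q²−q+1=0 the printed formula is 0/0; there γ_x(1) is shown to be a Möbius map, the limit of the formula as the parameter tends to q. For non-real q some curves reach infinity by time 1, so the map is claimed only where γ_x exists on [0,1], an open dense subset of H² (all of H² for real q). *)

theory Defs
  imports "HOL-Analysis.Analysis" "HOL-Computational_Algebra.Formal_Power_Series"
begin

definition upper_half_plane :: "complex set" where
  "upper_half_plane = {x. Im x > 0}"

text \<open>
  The coefficient of the vector field. It is polymorphic so that \<open>q\<close> can be a complex number
  as well as the formal variable of \<open>complex fps\<close>.
\<close>

definition field_D0 :: "'a::comm_ring_1 \<Rightarrow> 'a \<Rightarrow> 'a" where
  "field_D0 q x = (1 + (q - 1) * x) * (1 + (x - 1) * q)"

text \<open>
  For non-real \<open>q\<close> the field is not tangent to the real line, so an integral curve that starts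
  in the upper half-plane may leave it; the curve is therefore taken in the whole complex plane.
  At the end points of the time interval the derivative is one-sided.
\<close>

definition integral_curve :: "complex \<Rightarrow> complex \<Rightarrow> (real \<Rightarrow> complex) \<Rightarrow> bool" where
  "integral_curve q x \<gamma> \<longleftrightarrow> \<gamma> 0 = x \<and>
     (\<forall>t\<in>{0..1}. (\<gamma> has_vector_derivative field_D0 q (\<gamma> t)) (at t within {0..1}))"

text \<open>
  The field is quadratic, so for non-real \<open>q\<close> some integral curves reach infinity before time 1.
\<close>

definition flow_domain :: "complex \<Rightarrow> complex set" where
  "flow_domain q = {x \<in> upper_half_plane. \<exists>\<gamma>. integral_curve q x \<gamma>}"

definition moebius_map :: "'a::{comm_ring_1,inverse} \<Rightarrow> 'a \<Rightarrow> 'a \<Rightarrow> 'a \<Rightarrow> 'a \<Rightarrow> 'a" where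
  "moebius_map a b c d x = (a * x + b) / (c * x + d)"

text \<open>
  The entries of the matrix of the time-one map; \<open>u\<close> and \<open>v\<close> stand for
  \<open>exp q\<close> and \<open>exp (- (q - 1)\<^sup>2)\<close>.
\<close>

definition coeff_a :: "'a::comm_ring_1 \<Rightarrow> 'a \<Rightarrow> 'a \<Rightarrow> 'a" where
  "coeff_a q u v = q * u + (q - 1)\<^sup>2 * v"

definition coeff_b :: "'a::comm_ring_1 \<Rightarrow> 'a \<Rightarrow> 'a \<Rightarrow> 'a" where
  "coeff_b q u v = (1 - q) * (u - v)"

definition coeff_c :: "'a::comm_ring_1 \<Rightarrow> 'a \<Rightarrow> 'a \<Rightarrow> 'a" where
  "coeff_c q u v = q * (1 - q) * (u - v)"

definition coeff_d :: "'a::comm_ring_1 \<Rightarrow> 'a \<Rightarrow> 'a \<Rightarrow> 'a" where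
  "coeff_d q u v = (1 - q)\<^sup>2 * u + q * v"

definition time_one_map :: "complex \<Rightarrow> complex \<Rightarrow> complex" where
  "time_one_map q x = (let u = exp q; v = exp (- ((q - 1)\<^sup>2)) in
     moebius_map (coeff_a q u v) (coeff_b q u v) (coeff_c q u v) (coeff_d q u v) x)"

text \<open>
  The formal parameter is \<open>fps_X\<close>. A curve of formal power series is differentiated
  coefficientwise in the real time variable.
\<close>

definition formal_integral_curve :: "complex \<Rightarrow> (real \<Rightarrow> complex fps) \<Rightarrow> bool" where
  "formal_integral_curve x \<Gamma> \<longleftrightarrow> \<Gamma> 0 = fps_const x \<and>
     (\<forall>t\<in>{0..1}. \<forall>n. ((\<lambda>s. fps_nth (\<Gamma> s) n) has_vector_derivative
        fps_nth (field_D0 fps_X (\<Gamma> t)) n) (at t within {0..1}))"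

text \<open>
  The exponential of a formal power series. Composition needs a vanishing constant term,
  so the constant term of \<open>f\<close> is exponentiated separately.
\<close>

definition fps_expo :: "complex fps \<Rightarrow> complex fps" where
  "fps_expo f = fps_const (exp (fps_nth f 0)) *
     fps_compose (fps_exp 1) (f - fps_const (fps_nth f 0))"

end

theory Submission
  imports Defs
begin

text \<open>
  The quadratic field is the projectivisation of the linear system
  \<open>y' = (q - (q - 1)\<^sup>2) y + (1 - q) z\<close>, \<open>z' = q (1 - q) y\<close> with \<open>x = y / z\<close>. Its matrix has the
  eigenvalues \<open>q\<close> and \<open>- (q - 1)\<^sup>2\<close>, whose difference is \<open>q\<^sup>2 - q + 1\<close>; away from its zeros the
  exponential of the matrix is the matrix of the claim divided by this difference, and at a zero
  (a double eigenvalue) it is the limit of these quotients. A curve solves the equation on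
  \<open>[0, 1]\<close> iff it is \<open>y / z\<close> there, with \<open>z\<close> free of zeros. Over formal power series the same
  computation applies, and the uniqueness argument goes by induction on the coefficient.
\<close>

section \<open>The complex flow\<close>

text \<open>With \<open>K\<close> an antiderivative of \<open>k\<close>, the integrating factor
  \<open>exp (- K)\<close> makes \<open>E * exp (- K)\<close> constant, and \<open>E a = 0\<close>
  fixes the constant.\<close>

lemma linear_ode_zero:
  fixes E k :: "real \<Rightarrow> complex"
  assumes k: "continuous_on {a..b} k"
    and E: "\<And>t. t \<in> {a..b} \<Longrightarrow> (E has_vector_derivative k t * E t) (at t within {a..b})"
    and E0: "E a = 0" and t: "t \<in> {a..b}"
  shows "E t = 0"
proof -
  define K where "K s = integral {a..s} k" for s
  have K: "(K has_vector_derivative k s) (at s within {a..b})" if "s \<in> {a..b}" for s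
    unfolding K_def using k that by (rule integral_has_vector_derivative)
  have expK: "((\<lambda>s. exp (- K s)) has_vector_derivative - k s * exp (- K s)) (at s within {a..b})"
    if "s \<in> {a..b}" for s
    using field_vector_diff_chain_within[OF has_vector_derivative_minus[OF K[OF that]],
        of exp "exp (- K s)"]
    by (simp add: o_def DERIV_exp has_field_derivative_at_within)
  have "((\<lambda>s. E s * exp (- K s)) has_vector_derivative 0) (at s within {a..b})"
    if "s \<in> {a..b}" for s
    using has_vector_derivative_mult[OF E[OF that] expK[OF that]] by (simp add: algebra_simps)
  then obtain C where C: "\<And>s. s \<in> {a..b} \<Longrightarrow> E s * exp (- K s) = C"
    using has_vector_derivative_zero_constant[of "{a..b}" "\<lambda>s. E s * exp (- K s)"]
    by (metis convex_real_interval(5))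
  have "C = 0"
    using C[of a] E0 t by auto
  with C[OF t] show ?thesis
    by simp
qed

section \<open>The linearised system\<close>

text \<open>
  The exponential of \<open>t\<close> times the matrix \<open>M\<close> of the linear system is
  \<open>v + w (M + (q - 1)\<^sup>2)\<close>, also for a double eigenvalue.
\<close>

definition flow_v :: "complex \<Rightarrow> real \<Rightarrow> complex" where
  "flow_v q t = exp (- ((q - 1)\<^sup>2) * of_real t)"

text \<open>The divided difference of \<open>exp (t z)\<close> in \<open>z\<close> at the
  eigenvalues \<open>q\<close> and \<open>- (q - 1)\<^sup>2\<close>; at a double eigenvalue, the
  derivative in \<open>z\<close>.\<close>

definition flow_w :: "complex \<Rightarrow> real \<Rightarrow> complex" where
  "flow_w q t = (if q\<^sup>2 - q + 1 = 0 then of_real t * exp (q * of_real t)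
     else (exp (q * of_real t) - flow_v q t) / (q\<^sup>2 - q + 1))"

text \<open>With \<open>flow_den\<close>, the components \<open>y\<close> and \<open>z\<close> of
  the solution that starts at \<open>(x, 1)\<close>.\<close>

definition flow_num :: "complex \<Rightarrow> complex \<Rightarrow> real \<Rightarrow> complex" where
  "flow_num q x t = (flow_v q t + q * flow_w q t) * x + (1 - q) * flow_w q t"

definition flow_den :: "complex \<Rightarrow> complex \<Rightarrow> real \<Rightarrow> complex" where
  "flow_den q x t = q * (1 - q) * flow_w q t * x + (flow_v q t + (q - 1)\<^sup>2 * flow_w q t)"

lemma flow_v_nonzero [simp]: "flow_v q t \<noteq> 0"
  by (simp add: flow_v_def)

lemma flow_at_0 [simp]: "flow_v q 0 = 1" "flow_w q 0 = 0" "flow_num q x 0 = x" "flow_den q x 0 = 1"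
  by (simp_all add: flow_v_def flow_w_def flow_num_def flow_den_def)

text \<open>The relation that characterises the divided difference; it spares
  \<open>flow_det\<close> and \<open>flow_at_1\<close> the case distinction of
  \<open>flow_w\<close>.\<close>

lemma flow_v_plus_w: "flow_v q t + (q\<^sup>2 - q + 1) * flow_w q t = exp (q * of_real t)"
proof (cases "q\<^sup>2 - q + 1 = 0")
  case True
  then have "- ((q - 1)\<^sup>2) = q"
    by (simp add: power2_eq_square algebra_simps add_eq_0_iff2)
  with True show ?thesis
    by (simp add: flow_v_def)
qed (simp add: flow_w_def)

lemma flow_v_deriv: "(flow_v q has_vector_derivative - ((q - 1)\<^sup>2) * flow_v q t) (at t within S)"
proof -
  have "((\<lambda>z. exp (- ((q - 1)\<^sup>2) * z)) has_field_derivative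
      - ((q - 1)\<^sup>2) * exp (- ((q - 1)\<^sup>2) * of_real t)) (at (of_real t))"
    by (auto intro!: derivative_eq_intros)
  from has_vector_derivative_real_field[OF this] show ?thesis
    unfolding flow_v_def by simp
qed

text \<open>One equation for both cases of \<open>flow_w\<close>, so that the linear system below is
  verified uniformly in \<open>q\<close>.\<close>

lemma flow_w_deriv: "(flow_w q has_vector_derivative q * flow_w q t + flow_v q t) (at t within S)"
proof (cases "q\<^sup>2 - q + 1 = 0")
  case True
  have "((\<lambda>z. z * exp (q * z)) has_field_derivative
      q * (of_real t * exp (q * of_real t)) + exp (q * of_real t)) (at (of_real t))"
    by (auto intro!: derivative_eq_intros)
  from has_vector_derivative_real_field[OF this] show ?thesis
    using flow_v_plus_w[of q t] True unfolding flow_w_def by simp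
next
  case False
  have "((\<lambda>z. (exp (q * z) - exp (- ((q - 1)\<^sup>2) * z)) / (q\<^sup>2 - q + 1)) has_field_derivative
      (q * exp (q * of_real t) + (q - 1)\<^sup>2 * flow_v q t) / (q\<^sup>2 - q + 1)) (at (of_real t))"
    using False by (auto intro!: derivative_eq_intros simp: flow_v_def)
  from has_vector_derivative_real_field[OF this]
  have "(flow_w q has_vector_derivative
      (q * exp (q * of_real t) + (q - 1)\<^sup>2 * flow_v q t) / (q\<^sup>2 - q + 1)) (at t within S)"
    using False unfolding flow_w_def flow_v_def by simp
  moreover have "(q * exp (q * of_real t) + (q - 1)\<^sup>2 * flow_v q t) / (q\<^sup>2 - q + 1) =
      q * flow_w q t + flow_v q t"
    unfolding flow_v_plus_w[of q t, symmetric] using False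
    by (simp add: divide_eq_eq) (simp add: power2_eq_square algebra_simps)
  ultimately show ?thesis
    by simp
qed

lemma flow_num_deriv:
  "(flow_num q x has_vector_derivative
     (q - (q - 1)\<^sup>2) * flow_num q x t + (1 - q) * flow_den q x t) (at t within S)"
  unfolding flow_num_def[abs_def]
  by (rule derivative_eq_intros flow_v_deriv flow_w_deriv refl)+
    (simp add: flow_den_def power2_eq_square algebra_simps)

lemma flow_den_deriv:
  "(flow_den q x has_vector_derivative q * (1 - q) * flow_num q x t) (at t within S)"
  unfolding flow_den_def[abs_def]
  by (rule derivative_eq_intros flow_v_deriv flow_w_deriv refl)+
    (simp add: flow_num_def power2_eq_square algebra_simps)

text \<open>The determinant of a matrix exponential is the product of the exponentials of the
  eigenvalues; in particular it is nonzero.\<close>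

lemma flow_det:
  "(flow_v q t + q * flow_w q t) * (flow_v q t + (q - 1)\<^sup>2 * flow_w q t)
    - (1 - q) * flow_w q t * (q * (1 - q) * flow_w q t) = flow_v q t * exp (q * of_real t)"
  unfolding flow_v_plus_w[of q t, symmetric] by (simp add: power2_eq_square algebra_simps)

text \<open>An invertible matrix does not send the nonzero vector \<open>(x, 1)\<close> to
  0.\<close>

lemma flow_num_nonzero:
  assumes "flow_den q x t = 0"
  shows "flow_num q x t \<noteq> 0"
proof
  assume num: "flow_num q x t = 0"
  \<comment> \<open>Eliminating \<open>x\<close> between numerator and denominator leaves the
    determinant.\<close>
  have "(flow_v q t + q * flow_w q t) * flow_den q x t
      - q * (1 - q) * flow_w q t * flow_num q x t = flow_v q t * exp (q * of_real t)"
    unfolding flow_det[symmetric] by (simp add: flow_num_def flow_den_def algebra_simps)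
  with assms num show False
    by simp
qed

section \<open>Integral curves as quotients\<close>

text \<open>
  For a solution \<open>g\<close> of the Riccati equation, the defect \<open>y - g z\<close> of a solution \<open>(y, z)\<close> of the
  linearised system satisfies a homogeneous linear equation.
\<close>

lemma riccati_defect:
  "(q - (q - 1)\<^sup>2) * y + (1 - q) * z - (g * (q * (1 - q) * y) + field_D0 q g * z)
    = (q - (q - 1)\<^sup>2 + q * (q - 1) * g) * (y - g * z)" for q :: "'a::comm_ring_1"
  unfolding field_D0_def power2_eq_square by (simp add: algebra_simps)

text \<open>The defect starts at 0 and solves a homogeneous linear equation, so
  \<open>y = \<gamma> z\<close> throughout. A zero of \<open>z\<close> would thus be a zero of
  \<open>y\<close>, which \<open>flow_num_nonzero\<close> excludes.\<close>

lemma integral_curve_imp_flow: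
  assumes \<gamma>: "integral_curve q x \<gamma>" and t: "t \<in> {0..1}"
  shows "flow_den q x t \<noteq> 0" "\<gamma> t = flow_num q x t / flow_den q x t"
proof -
  have \<gamma>': "(\<gamma> has_vector_derivative field_D0 q (\<gamma> s)) (at s within {0..1})"
    if "s \<in> {0..1}" for s
    using \<gamma> that unfolding integral_curve_def by blast
  then have cont: "continuous_on {0..1} \<gamma>"
    unfolding continuous_on_eq_continuous_within by (blast intro: has_vector_derivative_continuous)
  have "flow_num q x t - \<gamma> t * flow_den q x t = 0"
  proof (rule linear_ode_zero[OF _ _ _ t])
    show "continuous_on {0..1} (\<lambda>s. q - (q - 1)\<^sup>2 + q * (q - 1) * \<gamma> s)"
      by (intro continuous_intros cont)
    show "((\<lambda>s. flow_num q x s - \<gamma> s * flow_den q x s) has_vector_derivative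
        (q - (q - 1)\<^sup>2 + q * (q - 1) * \<gamma> s) * (flow_num q x s - \<gamma> s * flow_den q x s))
        (at s within {0..1})" if "s \<in> {0..1}" for s
      unfolding riccati_defect[symmetric]
      by (intro has_vector_derivative_diff has_vector_derivative_mult flow_num_deriv
          flow_den_deriv \<gamma>' that)
  qed (use \<gamma> in \<open>simp add: integral_curve_def\<close>)
  then have eq: "flow_num q x t = \<gamma> t * flow_den q x t"
    by simp
  then show "flow_den q x t \<noteq> 0"
    using flow_num_nonzero by fastforce
  with eq show "\<gamma> t = flow_num q x t / flow_den q x t"
    by simp
qed

lemma flow_integral_curve:
  assumes "\<And>t. t \<in> {0..1} \<Longrightarrow> flow_den q x t \<noteq> 0"
  shows "integral_curve q x (\<lambda>t. flow_num q x t / flow_den q x t)"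
  unfolding integral_curve_def
proof (intro conjI ballI)
  fix t :: real
  assume t: "t \<in> {0..1}"
  note den = assms[OF t]
  have inv: "((\<lambda>s. inverse (flow_den q x s)) has_vector_derivative
      q * (1 - q) * flow_num q x t * - (inverse (flow_den q x t) ^ Suc (Suc 0))) (at t within {0..1})"
    using field_vector_diff_chain_within[OF flow_den_deriv DERIV_inverse[OF den]]
    by (simp add: o_def)
  \<comment> \<open>The left side is the derivative of \<open>y * inverse z\<close> in the shape
    given by the product rule.\<close>
  have eq: "flow_num q x t *
        (q * (1 - q) * flow_num q x t * - (inverse (flow_den q x t) ^ Suc (Suc 0)))
      + ((q - (q - 1)\<^sup>2) * flow_num q x t + (1 - q) * flow_den q x t) * inverse (flow_den q x t)
      = field_D0 q (flow_num q x t / flow_den q x t)"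
    using den by (simp add: field_D0_def field_simps power2_eq_square)
  show "((\<lambda>t. flow_num q x t / flow_den q x t) has_vector_derivative
      field_D0 q (flow_num q x t / flow_den q x t)) (at t within {0..1})"
    using has_vector_derivative_mult[OF flow_num_deriv[of q x t] inv]
    unfolding eq by (simp add: divide_inverse)
qed simp

section \<open>Openness and density of the flow domain\<close>

lemma flow_domain_eq:
  "flow_domain q = {x \<in> upper_half_plane. \<forall>t\<in>{0..1}. flow_den q x t \<noteq> 0}"
  unfolding flow_domain_def using integral_curve_imp_flow(1) flow_integral_curve by blast

lemma open_upper_half_plane: "open upper_half_plane"
  unfolding upper_half_plane_def by (rule open_halfspace_Im_gt)

lemma continuous_on_flow_v: "continuous_on S (flow_v q)"
  by (auto simp: continuous_on_eq_continuous_within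
      intro: has_vector_derivative_continuous[OF flow_v_deriv])

lemma continuous_on_flow_w: "continuous_on S (flow_w q)"
  by (auto simp: continuous_on_eq_continuous_within
      intro: has_vector_derivative_continuous[OF flow_w_deriv])

text \<open>The zeros of the denominator form a closed set of pairs \<open>(t, x)\<close>; as time
  runs through a compact interval, their projection to \<open>x\<close> is closed.\<close>

lemma open_flow_domain: "open (flow_domain q)"
proof -
  have "closed {x. \<exists>t. t \<in> {0..1} \<and> (t, x) \<in> {z. flow_den q (snd z) (fst z) = 0}}"
    unfolding flow_den_def
    by (intro closed_compact_projection closed_Collect_eq continuous_intros
        continuous_on_compose2[OF continuous_on_flow_v] continuous_on_compose2[OF continuous_on_flow_w])
      auto
  then have "open (upper_half_plane - {x. \<exists>t\<in>{0..1}. flow_den q x t = 0})"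
    by (intro open_Diff open_upper_half_plane) (simp add: Bex_def)
  moreover have "upper_half_plane - {x. \<exists>t\<in>{0..1}. flow_den q x t = 0} = flow_domain q"
    by (auto simp: flow_domain_eq)
  ultimately show ?thesis
    by simp
qed

text \<open>
  The points that escape to infinity before time 1 lie on a differentiable curve, parametrised by
  the time of escape, so they form a null set.
\<close>

lemma upper_half_plane_subset_closure_flow_domain: "upper_half_plane \<subseteq> closure (flow_domain q)"
proof
  fix x
  assume x: "x \<in> upper_half_plane"
  \<comment> \<open>For \<open>t\<close> in \<open>S\<close> the denominator is a nonconstant affine
    function of the starting point, and \<open>f t\<close> is its zero.\<close>
  define S where "S = {t. q * (1 - q) * flow_w q t \<noteq> 0}"
  define f where "f t = - (flow_v q t + (q - 1)\<^sup>2 * flow_w q t) / (q * (1 - q) * flow_w q t)" for t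
  have dv: "flow_v q differentiable (at t within S)" and dw: "flow_w q differentiable (at t within S)"
    for t
    using flow_v_deriv flow_w_deriv differentiableI_vector by blast+
  have "f differentiable_on S"
    unfolding f_def[abs_def] differentiable_on_def
    by (intro ballI differentiable_divide differentiable_minus differentiable_add
        differentiable_mult differentiable_const dv dw) (simp add: S_def)
  \<comment> \<open>A differentiable map from a subset of the line into the real plane has a null
    image.\<close>
  then have null: "negligible (f ` S)"
    by (intro negligible_differentiable_image_lowdim) auto
  have escape: "y \<in> f ` S" if "flow_den q y t = 0" for y t
  proof
    have den: "q * (1 - q) * flow_w q t * y + (flow_v q t + (q - 1)\<^sup>2 * flow_w q t) = 0"
      using that unfolding flow_den_def .
    \<comment> \<open>If the coefficient of \<open>y\<close> were 0, the other summand would be 0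
      too, and with them the determinant.\<close>
    show t: "t \<in> S"
      using den flow_det[of q t] by (force simp: S_def)
    have "q * (1 - q) * flow_w q t * y = - (flow_v q t + (q - 1)\<^sup>2 * flow_w q t)"
      using den by (simp only: eq_neg_iff_add_eq_0)
    then show "y = f t"
      using t unfolding f_def S_def by (simp add: eq_divide_eq mult_ac)
  qed
  show "x \<in> closure (flow_domain q)"
    unfolding closure_iff_nhds_not_empty
  proof (intro allI impI)
    fix A V
    assume "V \<subseteq> A" "open V" "x \<in> V"
    \<comment> \<open>A nonempty open set is not null, so it contains a point off the image of
      \<open>f\<close>.\<close>
    then have "\<not> negligible (V \<inter> upper_half_plane)"
      using x open_upper_half_plane by (intro open_not_negligible) auto
    then have "\<not> V \<inter> upper_half_plane \<subseteq> f ` S"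
      using null negligible_subset by blast
    then show "flow_domain q \<inter> A \<noteq> {}"
      using \<open>V \<subseteq> A\<close> escape unfolding flow_domain_eq by blast
  qed
qed

section \<open>Real parameters\<close>

text \<open>For real \<open>q\<close> the matrix is real with positive determinant, and such a
  Moebius map preserves the upper half-plane.\<close>

lemma real_flow:
  assumes q: "q \<in> \<real>" and x: "x \<in> upper_half_plane"
  shows "flow_den q x t \<noteq> 0" "flow_num q x t / flow_den q x t \<in> upper_half_plane"
proof -
  obtain r where r: "q = of_real r"
    using q by (auto elim: Reals_cases)
  define u where "u = exp (r * t)"
  define v where "v = exp (- ((r - 1)\<^sup>2) * t)"
  define w where "w = (u - v) / (r\<^sup>2 - r + 1)"
  \<comment> \<open>The sum of squares used here equals \<open>r\<^sup>2 - r + 1/2\<close>.\<close>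
  have pos: "r\<^sup>2 - r + 1 > 0"
    using sum_squares_gt_zero_iff[of "r - 1/2" "1/2"] by (simp add: power2_eq_square algebra_simps)
  have "q\<^sup>2 - q + 1 = of_real (r\<^sup>2 - r + 1)"
    by (simp add: r)
  then have nz: "q\<^sup>2 - q + 1 \<noteq> 0"
    using pos by (metis less_irrefl of_real_eq_0_iff)
  have V: "flow_v q t = of_real v"
    unfolding flow_v_def v_def r by (simp flip: exp_of_real)
  have U: "exp (q * of_real t) = of_real u"
    unfolding u_def r by (simp flip: exp_of_real)
  have W: "flow_w q t = of_real w"
    unfolding flow_w_def V U using nz by (simp add: w_def r)
  define a b c d where "a = v + r * w" and "b = (1 - r) * w" and "c = r * (1 - r) * w"
    and "d = v + (r - 1)\<^sup>2 * w"
  have num: "flow_num q x t = of_real a * x + of_real b"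
    and den: "flow_den q x t = of_real c * x + of_real d"
    unfolding flow_num_def flow_den_def V W unfolding a_def b_def c_def d_def r by simp_all
  have "complex_of_real (a * d - b * c) = of_real (v * u)"
    using flow_det[of q t] unfolding V W U unfolding a_def b_def c_def d_def r by simp
  then have "a * d - b * c = v * u"
    by (simp only: of_real_eq_iff)
  then have det: "a * d - b * c > 0"
    by (simp add: u_def v_def)
  have x': "Im x > 0"
    using x by (simp add: upper_half_plane_def)
  \<comment> \<open>The imaginary part of a vanishing denominator gives \<open>c = 0\<close>, the
    real part then \<open>d = 0\<close>, against \<open>det\<close>.\<close>
  show nz: "flow_den q x t \<noteq> 0"
    using det x' unfolding den by (auto simp: complex_eq_iff)
  have "Im (flow_num q x t / flow_den q x t) =
      (a * d - b * c) * Im x / ((Re (flow_den q x t))\<^sup>2 + (Im (flow_den q x t))\<^sup>2)"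
    unfolding Im_divide num den by (simp add: algebra_simps)
  also have "\<dots> > 0"
    using det x' nz by (intro divide_pos_pos mult_pos_pos) (auto simp: complex_eq_iff sum_power2_gt_zero_iff)
  finally show "flow_num q x t / flow_den q x t \<in> upper_half_plane"
    by (simp add: upper_half_plane_def)
qed

section \<open>The time-one map\<close>

text \<open>The matrix of the claim is the exponential scaled by \<open>q\<^sup>2 - q + 1\<close>,
  hence the square. As a ring identity it serves complex and formal parameters alike.\<close>

lemma coeff_det:
  "coeff_a q u v * coeff_d q u v - coeff_b q u v * coeff_c q u v = (q\<^sup>2 - q + 1)\<^sup>2 * (u * v)"
  unfolding coeff_a_def coeff_b_def coeff_c_def coeff_d_def power2_eq_square
  by (simp add: algebra_simps)

text \<open>The factor \<open>q\<^sup>2 - q + 1\<close> cancels in the quotient unless it is 0, in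
  which case both sides of each equation are 0.\<close>

lemma flow_at_1:
  fixes q :: complex
  defines "u \<equiv> exp q" and "v \<equiv> exp (- ((q - 1)\<^sup>2))"
  shows "coeff_a q u v * x + coeff_b q u v = (q\<^sup>2 - q + 1) * flow_num q x 1"
    and "coeff_c q u v * x + coeff_d q u v = (q\<^sup>2 - q + 1) * flow_den q x 1"
proof -
  have v: "flow_v q 1 = v"
    by (simp add: flow_v_def v_def)
  have u: "u = v + (q\<^sup>2 - q + 1) * flow_w q 1"
    using flow_v_plus_w[of q 1] unfolding u_def v by simp
  show "coeff_a q u v * x + coeff_b q u v = (q\<^sup>2 - q + 1) * flow_num q x 1"
    "coeff_c q u v * x + coeff_d q u v = (q\<^sup>2 - q + 1) * flow_den q x 1"
    unfolding coeff_a_def coeff_b_def coeff_c_def coeff_d_def flow_num_def flow_den_def v u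
      power2_eq_square by (simp_all add: algebra_simps)
qed

lemma time_one_map_eq_flow:
  assumes "q\<^sup>2 - q + 1 \<noteq> 0"
  shows "time_one_map q x = flow_num q x 1 / flow_den q x 1"
  unfolding time_one_map_def Let_def moebius_map_def flow_at_1 using assms by simp

text \<open>The difference quotient of \<open>exp\<close> at 0, taken along
  \<open>h\<close>.\<close>

lemma tendsto_expm1_quotient:
  fixes h :: "'a::t2_space \<Rightarrow> complex"
  assumes "(h \<longlongrightarrow> 0) F" "eventually (\<lambda>z. h z \<noteq> 0) F"
  shows "((\<lambda>z. (exp (h z) - 1) / h z) \<longlongrightarrow> 1) F"
proof -
  have "((\<lambda>z. (exp z - 1) / z) \<longlongrightarrow> (1::complex)) (at 0)"
    using DERIV_exp[of "0::complex"] by (simp add: DERIV_def)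
  moreover have "filterlim h (at 0) F"
    using assms by (simp add: filterlim_at)
  ultimately show ?thesis
    by (rule filterlim_compose)
qed

text \<open>For \<open>r\<close> near \<open>q\<close>, with \<open>d = r\<^sup>2 - r + 1\<close>
  nonzero, \<open>flow_w r 1\<close> is \<open>flow_v r 1 * ((exp d - 1) / d)\<close>, and
  \<open>d\<close> tends to 0.\<close>

lemma flow_w_tendsto:
  assumes q: "q\<^sup>2 - q + 1 = (0::complex)"
  shows "eventually (\<lambda>r. r\<^sup>2 - r + 1 \<noteq> 0) (at q)"
    and "((\<lambda>r. flow_w r 1) \<longlongrightarrow> flow_w q 1) (at q)"
proof -
  have "r\<^sup>2 - r + 1 \<noteq> 0" if "r \<noteq> q" "r \<noteq> 1 - q" for r
  proof -
    \<comment> \<open>The second root of the polynomial is \<open>1 - q\<close>, because the roots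
      sum to 1.\<close>
    have "r\<^sup>2 - r + 1 = (r - q) * (r - (1 - q)) + (q\<^sup>2 - q + 1)"
      by (simp add: power2_eq_square algebra_simps)
    with q that show ?thesis
      by simp
  qed
  moreover have "eventually (\<lambda>r. r \<notin> {1 - q}) (at q)"
    by (metis islimpt_finite finite.emptyI finite.insertI islimpt_iff_eventually)
  moreover have "eventually (\<lambda>r. r \<noteq> q) (at q)"
    by (simp add: eventually_at_filter)
  ultimately show ev: "eventually (\<lambda>r. r\<^sup>2 - r + 1 \<noteq> 0) (at q)"
    by (auto elim: eventually_elim2)
  have "((\<lambda>r. r\<^sup>2 - r + 1) \<longlongrightarrow> q\<^sup>2 - q + 1) (at q)"
    by (intro tendsto_intros)
  then have "((\<lambda>r. flow_v r 1 * ((exp (r\<^sup>2 - r + 1) - 1) / (r\<^sup>2 - r + 1))) \<longlongrightarrow> flow_v q 1 * 1) (at q)"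
    unfolding q flow_v_def
    by (intro tendsto_intros tendsto_expm1_quotient ev)
  moreover have "eventually (\<lambda>r. flow_v r 1 * ((exp (r\<^sup>2 - r + 1) - 1) / (r\<^sup>2 - r + 1)) = flow_w r 1) (at q)"
    using ev
  proof eventually_elim
    case (elim r)
    have "flow_v r 1 * exp (r\<^sup>2 - r + 1) = exp r"
      unfolding flow_v_def by (simp add: power2_eq_square algebra_simps flip: exp_add)
    with elim show ?case
      unfolding flow_w_def by (simp add: algebra_simps)
  qed
  ultimately have "((\<lambda>r. flow_w r 1) \<longlongrightarrow> flow_v q 1 * 1) (at q)"
    by (rule Lim_transform_eventually)
  moreover have "flow_w q 1 = flow_v q 1"
    using flow_v_plus_w[of q 1] q by (simp add: flow_w_def)
  ultimately show "((\<lambda>r. flow_w r 1) \<longlongrightarrow> flow_w q 1) (at q)"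
    by simp
qed

text \<open>At \<open>r = q\<close> all four entries vanish and the formula reads 0/0, so only the
  punctured limit is meaningful. For \<open>r\<close> near \<open>q\<close> the common factor
  cancels, and what remains converges.\<close>

lemma time_one_map_tendsto:
  assumes q: "q\<^sup>2 - q + 1 = 0" and nz: "flow_den q x 1 \<noteq> 0"
  shows "((\<lambda>r. time_one_map r x) \<longlongrightarrow> flow_num q x 1 / flow_den q x 1) (at q)"
proof (rule Lim_transform_eventually)
  have v: "((\<lambda>r. flow_v r 1) \<longlongrightarrow> flow_v q 1) (at q)"
    unfolding flow_v_def by (intro tendsto_intros)
  show "((\<lambda>r. flow_num r x 1 / flow_den r x 1) \<longlongrightarrow> flow_num q x 1 / flow_den q x 1) (at q)"
    using nz unfolding flow_num_def flow_den_def
    by (intro tendsto_intros v flow_w_tendsto(2)[OF q])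
  show "eventually (\<lambda>r. flow_num r x 1 / flow_den r x 1 = time_one_map r x) (at q)"
    using flow_w_tendsto(1)[OF q] by eventually_elim (simp add: time_one_map_eq_flow)
qed

section \<open>The formal flow\<close>

definition has_coeff_derivative ::
    "(real \<Rightarrow> complex fps) \<Rightarrow> complex fps \<Rightarrow> real filter \<Rightarrow> bool" where
  "has_coeff_derivative F F' net \<longleftrightarrow>
     (\<forall>n. ((\<lambda>s. fps_nth (F s) n) has_vector_derivative fps_nth F' n) net)"

lemma has_coeff_derivative_const: "has_coeff_derivative (\<lambda>s. F) 0 net"
  by (simp add: has_coeff_derivative_def)

lemma has_coeff_derivative_add:
  assumes "has_coeff_derivative F F' net" "has_coeff_derivative G G' net"
  shows "has_coeff_derivative (\<lambda>s. F s + G s) (F' + G') net"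
  using assms by (auto simp: has_coeff_derivative_def intro: has_vector_derivative_add)

lemma has_coeff_derivative_diff:
  assumes "has_coeff_derivative F F' net" "has_coeff_derivative G G' net"
  shows "has_coeff_derivative (\<lambda>s. F s - G s) (F' - G') net"
  using assms by (auto simp: has_coeff_derivative_def intro: has_vector_derivative_diff)

text \<open>Each coefficient of a Cauchy product is a finite sum of products.\<close>

lemma has_coeff_derivative_mult:
  assumes "has_coeff_derivative F F' (at t within S)" "has_coeff_derivative G G' (at t within S)"
  shows "has_coeff_derivative (\<lambda>s. F s * G s) (F t * G' + F' * G t) (at t within S)"
  unfolding has_coeff_derivative_def fps_mult_nth fps_add_nth sum.distrib[symmetric]
  using assms unfolding has_coeff_derivative_def
  by (intro allI has_vector_derivative_sum has_vector_derivative_mult) auto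

lemma has_coeff_derivative_cmult:
  assumes "has_coeff_derivative F F' (at t within S)"
  shows "has_coeff_derivative (\<lambda>s. A * F s) (A * F') (at t within S)"
  using has_coeff_derivative_mult[OF has_coeff_derivative_const assms] by simp

lemma has_coeff_derivative_unique:
  assumes "has_coeff_derivative F F' (at t)" "has_coeff_derivative F F'' (at t)"
  shows "F' = F''"
  using assms unfolding has_coeff_derivative_def fps_eq_iff
  by (blast intro: vector_derivative_unique_at)

text \<open>The recursion for the coefficients of the inverse shows by strong induction that they
  are differentiable; differentiating \<open>F s * inverse (F s) = 1\<close> then identifies the
  derivative.\<close>

lemma has_coeff_derivative_inverse:
  assumes F: "has_coeff_derivative F F' (at t)" and nz: "\<And>s. fps_nth (F s) 0 \<noteq> 0"
  shows "has_coeff_derivative (\<lambda>s. inverse (F s)) (- F' * (inverse (F t))\<^sup>2) (at t)"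
proof -
  have F_diff: "(\<lambda>s. fps_nth (F s) n) differentiable (at t)" for n
    using F unfolding has_coeff_derivative_def by (blast intro: differentiableI_vector)
  have "(\<lambda>s. fps_nth (inverse (F s)) n) differentiable (at t)" for n
  proof (induction n rule: less_induct)
    case (less n)
    show ?case
    proof (cases n)
      case 0
      then show ?thesis
        using F_diff[of 0] nz by (simp add: differentiable_inverse)
    next
      case (Suc m)
      have eq: "(\<lambda>s. fps_nth (inverse (F s)) n) = (\<lambda>s. - inverse (fps_nth (F s) 0) *
          (\<Sum>i = 1..n. fps_nth (F s) i * fps_nth (inverse (F s)) (n - i)))"
        by (simp add: Suc fps_inverse_def)
      show ?thesis
        by (subst eq, intro differentiable_mult differentiable_minus differentiable_inverse
            differentiable_sum F_diff less ballI nz) (auto simp: Suc)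
    qed
  qed
  then have "\<exists>G'. has_coeff_derivative (\<lambda>s. inverse (F s)) G' (at t)"
    unfolding has_coeff_derivative_def
    by (intro exI[of _ "Abs_fps (\<lambda>n. vector_derivative (\<lambda>s. fps_nth (inverse (F s)) n) (at t))"])
      (simp add: vector_derivative_works)
  then obtain G' where G': "has_coeff_derivative (\<lambda>s. inverse (F s)) G' (at t)"
    by blast
  have inv: "F s * inverse (F s) = 1" for s
    using nz by (simp add: inverse_mult_eq_1')
  have "F t * G' + F' * inverse (F t) = 0"
    using has_coeff_derivative_mult[OF F G'] has_coeff_derivative_const[of 1 "at t"]
    unfolding inv by (rule has_coeff_derivative_unique)
  then have FG': "F t * G' = - (F' * inverse (F t))"
    by (simp add: add_eq_0_iff2)
  have "G' = inverse (F t) * (F t * G')"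
    using inv[of t] by (metis mult.assoc mult.commute mult_1)
  also have "\<dots> = - F' * (inverse (F t))\<^sup>2"
    unfolding FG' by (simp add: power2_eq_square mult_ac)
  finally have "G' = - F' * (inverse (F t))\<^sup>2" .
  with G' show ?thesis
    by simp
qed

section \<open>The formal exponential\<close>

text \<open>As \<open>g\<close> has no constant term, only the powers \<open>g ^ k\<close> with
  \<open>k \<le> n\<close> reach coefficient \<open>n\<close>, which is therefore a polynomial in
  time.\<close>

lemma fps_compose_exp_deriv:
  assumes g: "fps_nth g 0 = 0"
  shows "has_coeff_derivative (\<lambda>s. fps_compose (fps_exp 1) (fps_const (of_real s) * g))
     (g * fps_compose (fps_exp 1) (fps_const (of_real t) * g)) (at t within S)"
  unfolding has_coeff_derivative_def
proof
  fix n
  have pow: "fps_nth ((fps_const (of_real s) * g) ^ k) n = of_real s ^ k * fps_nth (g ^ k) n" for s k n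
    by (simp add: power_mult_distrib)
  \<comment> \<open>A common truncation at \<open>n\<close> for all \<open>m \<le> n\<close> lets
    the Cauchy product with \<open>g\<close> be assembled at the end.\<close>
  have compose: "fps_nth (fps_compose (fps_exp 1) (fps_const (of_real s) * g)) m
      = (\<Sum>k=0..n. of_real s ^ k / fact k * fps_nth (g ^ k) m)" if "m \<le> n" for s m
    unfolding fps_compose_nth pow using that startsby_zero_power_prefix[OF g]
    by (intro sum.mono_neutral_cong_left) auto
  have "((\<lambda>s. \<Sum>k=0..n. of_real s ^ k / fact k * fps_nth (g ^ k) n) has_vector_derivative
      (\<Sum>k=0..n. of_nat k * of_real t ^ (k - 1) / fact k * fps_nth (g ^ k) n)) (at t within S)"
  proof (intro has_vector_derivative_sum)
    fix k
    have "((\<lambda>z. z ^ k / fact k * fps_nth (g ^ k) n) has_field_derivative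
        of_nat k * of_real t ^ (k - 1) / fact k * fps_nth (g ^ k) n) (at (of_real t))"
      by (auto intro!: derivative_eq_intros)
    from has_vector_derivative_real_field[OF this]
    show "((\<lambda>s. of_real s ^ k / fact k * fps_nth (g ^ k) n) has_vector_derivative
        of_nat k * of_real t ^ (k - 1) / fact k * fps_nth (g ^ k) n) (at t within S)" .
  qed
  \<comment> \<open>The added term is 0 because \<open>g ^ Suc n\<close> has no coefficient at
    \<open>n\<close>; it makes room for the index shift, in which the term \<open>k = 0\<close>
    drops out.\<close>
  also have "(\<Sum>k=0..n. of_nat k * of_real t ^ (k - 1) / fact k * fps_nth (g ^ k) n)
      = (\<Sum>k=0..Suc n. of_nat k * of_real t ^ (k - 1) / fact k * fps_nth (g ^ k) n)"
    using startsby_zero_power_prefix[OF g, rule_format, of n "Suc n"] by (simp del: power_Suc)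
  also have "\<dots> = (\<Sum>k=0..n. of_real t ^ k / fact k * fps_nth (g * g ^ k) n)"
    by (subst sum.atLeast0_atMost_Suc_shift) (simp add: field_simps del: of_nat_Suc)
  also have "\<dots> = (\<Sum>i=0..n. fps_nth g i *
      (\<Sum>k=0..n. of_real t ^ k / fact k * fps_nth (g ^ k) (n - i)))"
    unfolding fps_mult_nth sum_distrib_left by (subst sum.swap) (simp add: mult_ac)
  also have "\<dots> = fps_nth (g * fps_compose (fps_exp 1) (fps_const (of_real t) * g)) n"
    unfolding fps_mult_nth by (intro sum.cong refl) (simp add: compose)
  finally show "((\<lambda>s. fps_nth (fps_compose (fps_exp 1) (fps_const (of_real s) * g)) n)
      has_vector_derivative fps_nth (g * fps_compose (fps_exp 1) (fps_const (of_real t) * g)) n)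
      (at t within S)"
    by (simp add: compose)
qed

text \<open>Product rule: the scalar exponential contributes the constant term of \<open>f\<close>,
  the composition the rest.\<close>

lemma fps_expo_deriv:
  "has_coeff_derivative (\<lambda>s. fps_expo (fps_const (of_real s) * f))
     (f * fps_expo (fps_const (of_real t) * f)) (at t within S)"
proof -
  define g where "g = f - fps_const (fps_nth f 0)"
  have expo: "fps_expo (fps_const (of_real s) * f) = fps_const (exp (of_real s * fps_nth f 0)) *
      fps_compose (fps_exp 1) (fps_const (of_real s) * g)" for s
    by (simp add: fps_expo_def g_def right_diff_distrib)
  have "((\<lambda>z. exp (z * fps_nth f 0)) has_field_derivative
      fps_nth f 0 * exp (of_real t * fps_nth f 0)) (at (of_real t))"
    by (auto intro!: derivative_eq_intros)
  from has_vector_derivative_real_field[OF this]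
  have c: "has_coeff_derivative (\<lambda>s. fps_const (exp (of_real s * fps_nth f 0)))
      (fps_const (fps_nth f 0 * exp (of_real t * fps_nth f 0))) (at t within S)"
    unfolding has_coeff_derivative_def by simp
  have f: "f = g + fps_const (fps_nth f 0)"
    by (simp add: g_def)
  have "f * fps_expo (fps_const (of_real t) * f) =
      fps_const (exp (of_real t * fps_nth f 0)) *
        (g * fps_compose (fps_exp 1) (fps_const (of_real t) * g)) +
      fps_const (fps_nth f 0 * exp (of_real t * fps_nth f 0)) *
        fps_compose (fps_exp 1) (fps_const (of_real t) * g)"
    unfolding expo by (subst f) (simp add: algebra_simps flip: fps_const_mult)
  then show ?thesis
    using has_coeff_derivative_mult[OF c fps_compose_exp_deriv[of g]]
    unfolding expo by (simp add: g_def)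
qed

lemma fps_expo_nth_0 [simp]: "fps_nth (fps_expo f) 0 = exp (fps_nth f 0)"
  by (simp add: fps_expo_def)

lemma fps_expo_0 [simp]: "fps_expo 0 = 1"
  by (simp add: fps_expo_def)

text \<open>Once the lower coefficients of \<open>E\<close> vanish on the whole interval,
  coefficient \<open>n\<close> solves the scalar equation with coefficient
  \<open>fps_nth (k t) 0\<close>.\<close>

lemma linear_ode_zero_fps:
  assumes k: "\<And>n. continuous_on {a..b} (\<lambda>t. fps_nth (k t) n)"
    and E: "\<And>t. t \<in> {a..b} \<Longrightarrow> has_coeff_derivative E (k t * E t) (at t within {a..b})"
    and E0: "E a = 0" and t: "t \<in> {a..b}"
  shows "E t = 0"
proof -
  have "fps_nth (E t) n = 0" if "t \<in> {a..b}" for n t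
    using that
  proof (induction n arbitrary: t rule: less_induct)
    case (less n)
    show ?case
    proof (rule linear_ode_zero[OF k[of 0] _ _ less.prems])
      fix s
      assume s: "s \<in> {a..b}"
      have "fps_nth (k s * E s) n = fps_nth (k s) 0 * fps_nth (E s) n"
        unfolding fps_mult_nth using less.IH s by (subst sum.atLeast_Suc_atMost) auto
      with E[OF s] show "((\<lambda>t. fps_nth (E t) n) has_vector_derivative
          fps_nth (k s) 0 * fps_nth (E s) n) (at s within {a..b})"
        unfolding has_coeff_derivative_def by metis
    qed (simp add: E0)
  qed
  with t show ?thesis
    by (simp add: fps_eq_iff)
qed

section \<open>The formal solution\<close>

definition formal_u :: "real \<Rightarrow> complex fps" where
  "formal_u t = fps_expo (fps_const (of_real t) * fps_X)"

definition formal_v :: "real \<Rightarrow> complex fps" where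
  "formal_v t = fps_expo (fps_const (of_real t) * - ((fps_X - 1)\<^sup>2))"

text \<open>Unlike \<open>flow_num\<close>, this keeps the factor
  \<open>fps_X\<^sup>2 - fps_X + 1\<close>, which cancels in the quotient.\<close>

definition formal_num :: "complex \<Rightarrow> real \<Rightarrow> complex fps" where
  "formal_num x t = coeff_a fps_X (formal_u t) (formal_v t) * fps_const x +
     coeff_b fps_X (formal_u t) (formal_v t)"

definition formal_den :: "complex \<Rightarrow> real \<Rightarrow> complex fps" where
  "formal_den x t = coeff_c fps_X (formal_u t) (formal_v t) * fps_const x +
     coeff_d fps_X (formal_u t) (formal_v t)"

text \<open>Hence the denominator is a unit at every time, and no formal curve escapes.\<close>

lemma formal_den_nth_0 [simp]: "fps_nth (formal_den x t) 0 = 1"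
  by (simp add: formal_den_def coeff_c_def coeff_d_def formal_u_def power2_eq_square)

lemma formal_u_deriv: "has_coeff_derivative formal_u (fps_X * formal_u t) (at t within S)"
  unfolding formal_u_def[abs_def] by (rule fps_expo_deriv)

lemma formal_v_deriv:
  "has_coeff_derivative formal_v (- ((fps_X - 1)\<^sup>2) * formal_v t) (at t within S)"
  unfolding formal_v_def[abs_def] by (rule fps_expo_deriv)

lemma formal_num_deriv:
  "has_coeff_derivative (formal_num x)
     ((fps_X - (fps_X - 1)\<^sup>2) * formal_num x t + (1 - fps_X) * formal_den x t) (at t within S)"
proof -
  \<comment> \<open>The coefficients of the two exponentials, each of which differentiates to a
    multiple of itself.\<close>
  define A B where "A = fps_X * fps_const x + (1 - fps_X)"
    and "B = (fps_X - 1)\<^sup>2 * fps_const x - (1 - fps_X)"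
  have "formal_num x = (\<lambda>t. A * formal_u t + B * formal_v t)"
    by (simp add: fun_eq_iff formal_num_def coeff_a_def coeff_b_def A_def B_def algebra_simps)
  moreover have "(fps_X - (fps_X - 1)\<^sup>2) * formal_num x t + (1 - fps_X) * formal_den x t
      = A * (fps_X * formal_u t) + B * (- ((fps_X - 1)\<^sup>2) * formal_v t)"
    unfolding formal_num_def formal_den_def coeff_a_def coeff_b_def coeff_c_def coeff_d_def
      A_def B_def power2_eq_square by algebra
  ultimately show ?thesis
    by (simp only: has_coeff_derivative_add has_coeff_derivative_cmult formal_u_deriv formal_v_deriv)
qed

lemma formal_den_deriv:
  "has_coeff_derivative (formal_den x) (fps_X * (1 - fps_X) * formal_num x t) (at t within S)"
proof -
  define A B where "A = fps_X * (1 - fps_X) * fps_const x + (1 - fps_X)\<^sup>2"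
    and "B = fps_X - fps_X * (1 - fps_X) * fps_const x"
  have "formal_den x = (\<lambda>t. A * formal_u t + B * formal_v t)"
    by (simp add: fun_eq_iff formal_den_def coeff_c_def coeff_d_def A_def B_def algebra_simps)
  moreover have "fps_X * (1 - fps_X) * formal_num x t
      = A * (fps_X * formal_u t) + B * (- ((fps_X - 1)\<^sup>2) * formal_v t)"
    unfolding formal_num_def formal_den_def coeff_a_def coeff_b_def coeff_c_def coeff_d_def
      A_def B_def power2_eq_square by algebra
  ultimately show ?thesis
    by (simp only: has_coeff_derivative_add has_coeff_derivative_cmult formal_u_deriv formal_v_deriv)
qed

lemma formal_at_0:
  "formal_num x 0 = fps_const x * formal_den x 0"
  unfolding formal_num_def formal_den_def formal_u_def formal_v_def
    coeff_a_def coeff_b_def coeff_c_def coeff_d_def power2_eq_square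
  by (simp add: algebra_simps)

lemma formal_integral_curve_exists: "\<exists>\<Gamma>. formal_integral_curve x \<Gamma>"
proof
  define \<Gamma> where "\<Gamma> t = formal_num x t * inverse (formal_den x t)" for t
  have inv: "formal_den x t * inverse (formal_den x t) = 1" for t
    by (simp add: inverse_mult_eq_1')
  have "has_coeff_derivative \<Gamma> (field_D0 fps_X (\<Gamma> t)) (at t)" for t
  proof -
    \<comment> \<open>In these names the claim is a polynomial identity modulo
      \<open>z * i = 1\<close>.\<close>
    define y z i where "y = formal_num x t" and "z = formal_den x t"
      and "i = inverse (formal_den x t)"
    have zi: "z * i = 1"
      unfolding z_def i_def by (rule inv)
    have "field_D0 fps_X (\<Gamma> t) = y * (- (fps_X * (1 - fps_X) * y) * i\<^sup>2)
        + ((fps_X - (fps_X - 1)\<^sup>2) * y + (1 - fps_X) * z) * i"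
      unfolding \<Gamma>_def y_def[symmetric] i_def[symmetric] field_D0_def power2_eq_square
      using zi by algebra
    then show ?thesis
      using has_coeff_derivative_mult[OF formal_num_deriv
          has_coeff_derivative_inverse[OF formal_den_deriv]]
      unfolding \<Gamma>_def[abs_def] y_def z_def i_def by simp
  qed
  then have "has_coeff_derivative \<Gamma> (field_D0 fps_X (\<Gamma> t)) (at t within {0..1})" for t
    unfolding has_coeff_derivative_def by (blast intro: has_vector_derivative_at_within)
  moreover have "\<Gamma> 0 = fps_const x"
    unfolding \<Gamma>_def formal_at_0 using inv[of 0] by (simp add: mult.assoc)
  ultimately show "formal_integral_curve x \<Gamma>"
    unfolding formal_integral_curve_def has_coeff_derivative_def by blast
qed

text \<open>The defect vanishes as in the complex case, now by \<open>linear_ode_zero_fps\<close>,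
  and the denominator can be divided out as a unit.\<close>

lemma formal_integral_curve_imp_flow:
  assumes \<Gamma>: "formal_integral_curve x \<Gamma>" and t: "t \<in> {0..1}"
  shows "\<Gamma> t = formal_num x t / formal_den x t"
proof -
  have \<Gamma>': "has_coeff_derivative \<Gamma> (field_D0 fps_X (\<Gamma> s)) (at s within {0..1})"
    if "s \<in> {0..1}" for s
    using \<Gamma> that unfolding formal_integral_curve_def has_coeff_derivative_def by blast
  then have cont: "continuous_on {0..1} (\<lambda>s. fps_nth (\<Gamma> s) n)" for n
    unfolding has_coeff_derivative_def continuous_on_eq_continuous_within
    by (blast intro: has_vector_derivative_continuous)
  have "formal_num x t - \<Gamma> t * formal_den x t = 0"
  proof (rule linear_ode_zero_fps[OF _ _ _ t])
    show "continuous_on {0..1} (\<lambda>s. fps_nth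
        (fps_X - (fps_X - 1)\<^sup>2 + fps_X * (fps_X - 1) * \<Gamma> s) n)" for n
      unfolding fps_add_nth fps_mult_nth[of _ "\<Gamma> _"] by (intro continuous_intros cont)
    show "has_coeff_derivative (\<lambda>s. formal_num x s - \<Gamma> s * formal_den x s)
        ((fps_X - (fps_X - 1)\<^sup>2 + fps_X * (fps_X - 1) * \<Gamma> s) *
          (formal_num x s - \<Gamma> s * formal_den x s)) (at s within {0..1})" if "s \<in> {0..1}" for s
      unfolding riccati_defect[symmetric]
      by (intro has_coeff_derivative_diff has_coeff_derivative_mult formal_num_deriv
          formal_den_deriv \<Gamma>' that)
  qed (use \<Gamma> in \<open>simp add: formal_integral_curve_def formal_at_0\<close>)
  then have "formal_num x t = \<Gamma> t * formal_den x t"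
    by simp
  then show ?thesis
    by (simp add: fps_divide_unit mult.assoc inverse_mult_eq_1')
qed

theorem proposition4p2:
  shows
    "(\<forall>q::complex. q \<noteq> 0 \<longrightarrow>
        open (flow_domain q) \<and> upper_half_plane \<subseteq> closure (flow_domain q) \<and>
        (q \<in> \<real> \<longrightarrow>
           (\<forall>x\<in>upper_half_plane. \<exists>\<gamma>. integral_curve q x \<gamma> \<and> \<gamma> ` {0..1} \<subseteq> upper_half_plane)) \<and>
        (\<forall>x\<in>upper_half_plane. \<forall>\<gamma> \<eta>. integral_curve q x \<gamma> \<longrightarrow> integral_curve q x \<eta> \<longrightarrow>
           (\<forall>t\<in>{0..1}. \<gamma> t = \<eta> t)) \<and>
        (q\<^sup>2 - q + 1 \<noteq> 0 \<longrightarrow>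
           (let u = exp q; v = exp (- ((q - 1)\<^sup>2));
                a = coeff_a q u v; b = coeff_b q u v; c = coeff_c q u v; d = coeff_d q u v
            in a * d - b * c \<noteq> 0 \<and>
               (\<forall>x\<in>upper_half_plane. \<forall>\<gamma>. integral_curve q x \<gamma> \<longrightarrow>
                  c * x + d \<noteq> 0 \<and> \<gamma> 1 = time_one_map q x))) \<and>
        (q\<^sup>2 - q + 1 = 0 \<longrightarrow>
           (\<exists>a b c d. a * d - b * c \<noteq> 0 \<and>
               (\<forall>x\<in>upper_half_plane. \<forall>\<gamma>. integral_curve q x \<gamma> \<longrightarrow>
                  c * x + d \<noteq> 0 \<and> \<gamma> 1 = moebius_map a b c d x \<and>
                  ((\<lambda>r. time_one_map r x) \<longlongrightarrow> \<gamma> 1) (at q))))) \<and>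
     (let q = fps_X; u = fps_expo q; v = fps_expo (- ((q - 1)\<^sup>2));
          a = coeff_a q u v; b = coeff_b q u v; c = coeff_c q u v; d = coeff_d q u v
      in a * d - b * c \<noteq> 0 \<and>
         (\<forall>x\<in>upper_half_plane.
            fps_nth (c * fps_const x + d) 0 \<noteq> 0 \<and>
            (\<exists>\<Gamma>. formal_integral_curve x \<Gamma>) \<and>
            (\<forall>\<Gamma>. formal_integral_curve x \<Gamma> \<longrightarrow>
               \<Gamma> 1 = moebius_map a b c d (fps_const x))))"
proof (intro conjI allI impI)
  fix q :: complex
  assume "q \<noteq> 0"
  show "open (flow_domain q)" "upper_half_plane \<subseteq> closure (flow_domain q)"
    by (rule open_flow_domain upper_half_plane_subset_closure_flow_domain)+
  show "\<forall>x\<in>upper_half_plane. \<exists>\<gamma>. integral_curve q x \<gamma> \<and> \<gamma> ` {0..1} \<subseteq> upper_half_plane"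
    if "q \<in> \<real>"
  proof
    fix x
    assume x: "x \<in> upper_half_plane"
    show "\<exists>\<gamma>. integral_curve q x \<gamma> \<and> \<gamma> ` {0..1} \<subseteq> upper_half_plane"
      using flow_integral_curve[OF real_flow(1)[OF that x]] real_flow(2)[OF that x]
      by (intro exI conjI image_subsetI)
  qed
  show "\<forall>x\<in>upper_half_plane. \<forall>\<gamma> \<eta>. integral_curve q x \<gamma> \<longrightarrow> integral_curve q x \<eta> \<longrightarrow>
      (\<forall>t\<in>{0..1}. \<gamma> t = \<eta> t)"
    using integral_curve_imp_flow(2) by metis
  show "let u = exp q; v = exp (- ((q - 1)\<^sup>2));
      a = coeff_a q u v; b = coeff_b q u v; c = coeff_c q u v; d = coeff_d q u v
    in a * d - b * c \<noteq> 0 \<and>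
       (\<forall>x\<in>upper_half_plane. \<forall>\<gamma>. integral_curve q x \<gamma> \<longrightarrow>
          c * x + d \<noteq> 0 \<and> \<gamma> 1 = time_one_map q x)"
    if "q\<^sup>2 - q + 1 \<noteq> 0"
    unfolding Let_def coeff_det flow_at_1 time_one_map_eq_flow[OF that]
    using that integral_curve_imp_flow[of q _ _ 1] by auto
  show "\<exists>a b c d. a * d - b * c \<noteq> 0 \<and>
       (\<forall>x\<in>upper_half_plane. \<forall>\<gamma>. integral_curve q x \<gamma> \<longrightarrow>
          c * x + d \<noteq> 0 \<and> \<gamma> 1 = moebius_map a b c d x \<and>
          ((\<lambda>r. time_one_map r x) \<longlongrightarrow> \<gamma> 1) (at q))"
    if q: "q\<^sup>2 - q + 1 = 0"
  proof (intro exI conjI ballI allI impI)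
    \<comment> \<open>The witness is the exponential matrix itself, since the matrix of the claim is
      zero for this \<open>q\<close>.\<close>
    show "(flow_v q 1 + q * flow_w q 1) * (flow_v q 1 + (q - 1)\<^sup>2 * flow_w q 1)
        - (1 - q) * flow_w q 1 * (q * (1 - q) * flow_w q 1) \<noteq> 0"
      unfolding flow_det by simp
    fix x \<gamma>
    assume "integral_curve q x \<gamma>"
    then have den: "flow_den q x 1 \<noteq> 0" and \<gamma>: "\<gamma> 1 = flow_num q x 1 / flow_den q x 1"
      using integral_curve_imp_flow[of q x \<gamma> 1] by auto
    show "q * (1 - q) * flow_w q 1 * x + (flow_v q 1 + (q - 1)\<^sup>2 * flow_w q 1) \<noteq> 0"
      using den unfolding flow_den_def .
    show "\<gamma> 1 = moebius_map (flow_v q 1 + q * flow_w q 1) ((1 - q) * flow_w q 1)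
        (q * (1 - q) * flow_w q 1) (flow_v q 1 + (q - 1)\<^sup>2 * flow_w q 1) x"
      unfolding \<gamma> moebius_map_def flow_num_def flow_den_def ..
    show "((\<lambda>r. time_one_map r x) \<longlongrightarrow> \<gamma> 1) (at q)"
      unfolding \<gamma> by (rule time_one_map_tendsto[OF q den])
  qed
next
  have u: "fps_expo fps_X = formal_u 1" and v: "fps_expo (- ((fps_X - 1)\<^sup>2)) = formal_v 1"
    by (simp_all add: formal_u_def formal_v_def)
  \<comment> \<open>The constant coefficient already detects that the determinant is nonzero: it is
    \<open>exp 0 * exp (- 1)\<close>.\<close>
  have "fps_nth ((fps_X\<^sup>2 - fps_X + 1)\<^sup>2 * (formal_u 1 * formal_v 1)) 0 \<noteq> 0"
    by (simp add: formal_u_def formal_v_def power2_eq_square)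
  then have det: "(fps_X\<^sup>2 - fps_X + 1)\<^sup>2 * (formal_u 1 * formal_v 1) \<noteq> 0"
    by (metis fps_zero_nth)
  show "let q = fps_X; u = fps_expo q; v = fps_expo (- ((q - 1)\<^sup>2));
      a = coeff_a q u v; b = coeff_b q u v; c = coeff_c q u v; d = coeff_d q u v
    in a * d - b * c \<noteq> 0 \<and>
       (\<forall>x\<in>upper_half_plane.
          fps_nth (c * fps_const x + d) 0 \<noteq> 0 \<and>
          (\<exists>\<Gamma>. formal_integral_curve x \<Gamma>) \<and>
          (\<forall>\<Gamma>. formal_integral_curve x \<Gamma> \<longrightarrow>
             \<Gamma> 1 = moebius_map a b c d (fps_const x)))"
    unfolding Let_def u v coeff_det moebius_map_def
      formal_num_def[symmetric] formal_den_def[symmetric]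
    using det formal_integral_curve_exists formal_integral_curve_imp_flow[of _ _ 1] by simp
qed

end
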